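(* For any fixed positive integer $s$, $$\lim_{t\to\infty}\chi_f(W(s,t))=\infty.$$
   Context: Graphs are finite, simple and undirected. For positive integers $s,t$ the graph $W(s,t)$ has vertex set consisting of all sequences $(x_1,\dots,x_t)$ with $x_i\in\{0,1,\dots,s\}$ for all $i$, such that there is exactly one index $i$ with $x_i=0$ and at least one index $j$ with $x_j=1$. Two vertices $(x_1,\dots,x_t)$ and $(y_1,\dots,y_t)$ are adjacent if and only if for every $i$ either $|x_i-y_i|=1$ or $x_i=y_i=s$. For a graph $G$ and a positive integer $k$, the $k$-fold chromatic number $\chi_k(G)$ is the minimum $n$ such that one can assign to each vertex of $G$ a set of exactly $k$ distinct colors from $\{1,\dots,n\}$ in such a way that adjacent vertices receive disjoint sets. The fractional chromatic number of $G$ is $\chi_f(G)=\inf_{k\ge 1}\frac{\chi_k(G)}{k}$. *)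

theory Defs
  imports "HOL-Analysis.Analysis" "Graph_Theory.Graph_Theory"
begin

text \<open>
  A finite simple undirected graph is a \<^const>\<open>pair_graph\<close>: finite vertex set, and a symmetric
  irreflexive arc relation, in which an edge is represented by its two opposite arcs.
\<close>

text \<open>
  Sequences of length \<open>t\<close> are lists, indexed from 0 instead of 1. Differences of entries are taken
  in \<^typ>\<open>int\<close>, since subtraction on \<^typ>\<open>nat\<close> truncates.
\<close>

definition W_verts :: "nat \<Rightarrow> nat \<Rightarrow> nat list set" where
  "W_verts s t = {x. length x = t \<and> set x \<subseteq> {0..s} \<and>
     (\<exists>!i. i < t \<and> x ! i = 0) \<and> (\<exists>j<t. x ! j = 1)}"

definition W_adj :: "nat \<Rightarrow> nat \<Rightarrow> nat list \<Rightarrow> nat list \<Rightarrow> bool" where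
  "W_adj s t x y \<longleftrightarrow> (\<forall>i<t. \<bar>int (x ! i) - int (y ! i)\<bar> = 1 \<or> (x ! i = s \<and> y ! i = s))"

definition W :: "nat \<Rightarrow> nat \<Rightarrow> nat list pair_pre_digraph" where
  "W s t = \<lparr> pverts = W_verts s t,
             parcs = {(x, y). x \<in> W_verts s t \<and> y \<in> W_verts s t \<and> W_adj s t x y} \<rparr>"

definition fold_colouring :: "'a pair_pre_digraph \<Rightarrow> nat \<Rightarrow> nat \<Rightarrow> ('a \<Rightarrow> nat set) \<Rightarrow> bool" where
  "fold_colouring G k n c \<longleftrightarrow>
     (\<forall>v\<in>pverts G. c v \<subseteq> {1..n} \<and> card (c v) = k) \<and>
     (\<forall>(u, v)\<in>parcs G. c u \<inter> c v = {})"

definition fold_chromatic :: "nat \<Rightarrow> 'a pair_pre_digraph \<Rightarrow> nat" where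
  "fold_chromatic k G = (LEAST n. \<exists>c. fold_colouring G k n c)"

definition fractional_chromatic :: "'a pair_pre_digraph \<Rightarrow> real" where
  "fractional_chromatic G = (INF k\<in>{1..}. real (fold_chromatic k G) / real k)"

lemma pair_graph_W:
  assumes "s > 0"
  shows "pair_graph (W s t)"
proof -
  have "W_verts s t \<subseteq> {x. set x \<subseteq> {0..s} \<and> length x = t}"
    unfolding W_verts_def by blast
  then have fin: "finite (W_verts s t)"
    using finite_lists_length_eq[of "{0..s}" t] finite_subset by blast
  have "parcs (W s t) \<subseteq> W_verts s t \<times> W_verts s t"
    by (auto simp: W_def)
  then have fin': "finite (parcs (W s t))"
    using fin finite_subset by blast
  have irr: "\<not> W_adj s t x x" if "x \<in> W_verts s t" for x
  proof -
    from that obtain i where "i < t" "x ! i = 0"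
      unfolding W_verts_def by blast
    then show ?thesis
      using assms unfolding W_adj_def by fastforce
  qed
  have sym: "W_adj s t y x" if "W_adj s t x y" for x y
    using that unfolding W_adj_def by (metis abs_minus_commute)
  show ?thesis
  proof
    show "finite (pverts (W s t))"
      using fin by (simp add: W_def)
    show "finite (parcs (W s t))"
      by (rule fin')
    show "symmetric (with_proj (W s t))"
      using sym by (auto simp: symmetric_def W_def intro!: symI)
  qed (use irr in \<open>auto simp: W_def\<close>)
qed

text \<open>The minimum in the definition of the \<open>k\<close>-fold chromatic number is attained.\<close>

lemma fold_colouring_fold_chromatic:
  assumes "pair_graph G"
  shows "\<exists>c. fold_colouring G k (fold_chromatic k G) c"
proof -
  interpret pair_graph G by fact
  obtain f :: "'a \<Rightarrow> nat" where f: "inj_on f (pverts G)"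
    using finite_imp_inj_to_nat_seg[OF pair_finite_verts] by blast
  define N where "N = Suc (Max (insert 0 (f ` pverts G))) * k"
  define c where "c = (\<lambda>v. {f v * k + 1..f v * k + k})"
  have disj: "{a * k + 1..a * k + k} \<inter> {b * k + 1..b * k + k} = {}" if "a < b" for a b :: nat
  proof -
    have "a * k + k \<le> b * k"
      using mult_le_mono1[of "Suc a" b k] that by simp
    then show ?thesis by auto
  qed
  have "c v \<subseteq> {1..N} \<and> card (c v) = k" if "v \<in> pverts G" for v
  proof -
    have "f v \<le> Max (insert 0 (f ` pverts G))"
      using that pair_finite_verts by (intro Max_ge) auto
    then have "Suc (f v) * k \<le> N"
      unfolding N_def by (intro mult_le_mono1) auto
    then have "f v * k + k \<le> N"
      by simp
    then show ?thesis
      unfolding c_def by (simp)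
  qed
  moreover have "c u \<inter> c v = {}" if "(u, v) \<in> parcs G" for u v
  proof -
    have "f u \<noteq> f v"
      using inj_onD[OF f] in_arcsD1[OF that] in_arcsD2[OF that] no_loops'[OF that] by blast
    then consider "f u < f v" | "f v < f u"
      by linarith
    then show ?thesis
      unfolding c_def using disj by cases blast+
  qed
  ultimately have "fold_colouring G k N c"
    unfolding fold_colouring_def by blast
  then have "\<exists>c. fold_colouring G k N c"
    by blast
  then show ?thesis
    unfolding fold_chromatic_def by (rule LeastI)
qed

text \<open>The infimum is taken over a nonempty set that is bounded below.\<close>

lemma bdd_below_fold_chromatic:
  "bdd_below ((\<lambda>k. real (fold_chromatic k G) / real k) ` {1..})"
  by (rule bdd_belowI2[of _ 0]) simp

end

theory Submission
  imports Defs
begin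

text \<open>
  By weak duality it suffices to find fractional cliques of large weight. A generalised Mycielskian
  of \<open>W(s,t)\<close> with \<open>3s\<close> levels maps to \<open>W(s,t+1)\<close>. If every fractional clique of \<open>W(s,t)\<close> has
  weight at most \<open>B\<close>, then copying one of them to the level at distance \<open>d\<close> from the apex with
  factor \<open>B^d\<close>, giving the apex weight \<open>B\<close>, and dividing everything by \<open>S = B + \<dots> + B^(3s)\<close> yields
  a fractional clique whose weight is larger by \<open>B / S\<close>. This gain depends only on \<open>B\<close> and \<open>s\<close>, so
  the weights cannot stay below \<open>B\<close>.
\<close>

section \<open>Fractional cliques\<close>

definition indep :: "'a pair_pre_digraph \<Rightarrow> 'a set \<Rightarrow> bool" where
  "indep G I \<longleftrightarrow> I \<subseteq> pverts G \<and> (\<forall>u\<in>I. \<forall>v\<in>I. (u, v) \<notin> parcs G)"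

text \<open>Feasible points of the linear program dual to fractional colouring. The total weight is
  always read off as the sum over \<open>pverts G\<close>.\<close>

definition fractional_clique :: "'a pair_pre_digraph \<Rightarrow> ('a \<Rightarrow> real) \<Rightarrow> bool" where
  "fractional_clique G w \<longleftrightarrow> (\<forall>v. 0 \<le> w v) \<and> (\<forall>I. indep G I \<longrightarrow> sum w I \<le> 1)"

lemma fractional_cliqueD:
  assumes "fractional_clique G w"
  shows "0 \<le> w v" and "indep G I \<Longrightarrow> sum w I \<le> 1"
  using assms by (auto simp: fractional_clique_def)

context pair_graph
begin

lemma finite_indep: "indep G I \<Longrightarrow> finite I"
  unfolding indep_def using finite_subset pair_finite_verts by blast

lemma indep_singleton: "v \<in> pverts G \<Longrightarrow> indep G {v}"
  unfolding indep_def using no_loops' by auto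

lemma indep_Un:
  assumes "indep G I" "indep G K" "\<And>u v. u \<in> I \<Longrightarrow> v \<in> K \<Longrightarrow> (u, v) \<notin> parcs G"
  shows "indep G (I \<union> K)"
  using assms arcs_symmetric unfolding indep_def by blast

text \<open>Double counting in a \<open>k\<close>-fold colouring: every vertex weight is counted
  once for each of its \<open>k\<close> colours, while each of the \<open>n\<close> colour classes
  is independent and so weighs at most 1.\<close>

lemma fractional_clique_le_fractional_chromatic:
  assumes w: "fractional_clique G w"
  shows "sum w (pverts G) \<le> fractional_chromatic G"
  unfolding fractional_chromatic_def
proof (rule cINF_greatest)
  fix k :: nat
  assume "k \<in> {1..}"
  then have k: "k > 0" by simp
  define n where "n = fold_chromatic k G"
  obtain c where c: "fold_colouring G k n c"
    using fold_colouring_fold_chromatic[OF pair_graph_axioms] unfolding n_def by blast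
  have card: "card (c v) = card {j \<in> {1..n}. j \<in> c v}" if "v \<in> pverts G" for v
    using c that unfolding fold_colouring_def by (intro arg_cong[of _ _ card]) blast
  have "real k * sum w (pverts G) = (\<Sum>v\<in>pverts G. w v * real (card (c v)))"
    using c by (simp add: fold_colouring_def sum_distrib_left mult.commute)
  also have "\<dots> = (\<Sum>v\<in>pverts G. \<Sum>j\<in>{1..n}. if j \<in> c v then w v else 0)"
    by (rule sum.cong) (simp_all add: card sum.If_cases Int_def mult.commute del: atLeastAtMost_iff)
  also have "\<dots> = (\<Sum>j\<in>{1..n}. \<Sum>v\<in>pverts G. if j \<in> c v then w v else 0)"
    by (rule sum.swap)
  also have "\<dots> = (\<Sum>j\<in>{1..n}. sum w {v \<in> pverts G. j \<in> c v})"
    by (simp add: sum.If_cases pair_finite_verts Int_def)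
  also have "\<dots> \<le> (\<Sum>j\<in>{1..n}. 1)"
  proof (rule sum_mono)
    fix j
    have "indep G {v \<in> pverts G. j \<in> c v}"
      using c unfolding indep_def fold_colouring_def by blast
    then show "sum w {v \<in> pverts G. j \<in> c v} \<le> 1"
      by (rule fractional_cliqueD(2)[OF w])
  qed
  finally have "real k * sum w (pverts G) \<le> real n" by simp
  then show "sum w (pverts G) \<le> real (fold_chromatic k G) / real k"
    using k by (simp add: n_def field_simps)
qed simp

text \<open>Singletons are independent, so no vertex weighs more than 1. This crude estimate shows
  that some finite bound on all fractional cliques always exists.\<close>

lemma fractional_clique_le_card:
  assumes "fractional_clique G w"
  shows "sum w (pverts G) \<le> real (card (pverts G))"
proof -
  have "w v \<le> 1" if "v \<in> pverts G" for v
    using fractional_cliqueD(2)[OF assms indep_singleton[OF that]] by simp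
  then show ?thesis
    using sum_bounded_above[of "pverts G" w 1] by simp
qed

text \<open>Joining \<open>K\<close> to the part of an independent set inside \<open>H\<close> keeps
  it independent, so that part weighs at most \<open>1 - sum w K\<close>. Hence \<open>w\<close>
  restricted to \<open>H\<close> and divided by this number is again a fractional clique, to which
  \<open>B\<close> applies.\<close>

lemma sum_nonadjacent_le:
  assumes w: "fractional_clique G w"
    and bound: "\<And>w'. fractional_clique G w' \<Longrightarrow> sum w' (pverts G) \<le> B"
    and K: "indep G K" and H: "H \<subseteq> pverts G" "H \<inter> K = {}"
    and nonadj: "\<And>u v. u \<in> K \<Longrightarrow> v \<in> H \<Longrightarrow> (u, v) \<notin> parcs G"
  shows "sum w H \<le> (1 - sum w K) * B"
proof -
  have finH: "finite H" using H(1) pair_finite_verts finite_subset by blast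
  have part: "sum w (I \<inter> H) \<le> 1 - sum w K" if "indep G I" for I
  proof -
    have "indep G (I \<inter> H)" using that unfolding indep_def by blast
    then have "indep G (K \<union> (I \<inter> H))"
      by (intro indep_Un K) (use nonadj in auto)
    then have "sum w (K \<union> (I \<inter> H)) \<le> 1"
      by (rule fractional_cliqueD(2)[OF w])
    moreover have "sum w (K \<union> (I \<inter> H)) = sum w K + sum w (I \<inter> H)"
      using H finH finite_indep[OF K] by (intro sum.union_disjoint) auto
    ultimately show ?thesis by simp
  qed
  show ?thesis
  \<comment> \<open>If \<open>K\<close> has full weight, rescaling is impossible, but then
    \<open>w\<close> vanishes on \<open>H\<close>.\<close>
  proof (cases "sum w K = 1")
    case True
    have "w v \<le> 0" if "v \<in> H" for v
      using part[OF indep_singleton, of v] that H(1) True by auto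
    then show ?thesis using True by (simp add: sum_nonpos)
  next
    case False
    then have pos: "1 - sum w K > 0"
      using fractional_cliqueD(2)[OF w K] by simp
    define w' where "w' v = (if v \<in> H then w v / (1 - sum w K) else 0)" for v
    have sum': "sum w' I = sum w (I \<inter> H) / (1 - sum w K)" if "finite I" for I
      using that unfolding w'_def by (simp add: sum.If_cases sum_divide_distrib Int_def)
    have "fractional_clique G w'"
      unfolding fractional_clique_def
    proof (intro conjI allI impI)
      show "0 \<le> w' v" for v
        using pos fractional_cliqueD(1)[OF w] by (simp add: w'_def)
      show "sum w' I \<le> 1" if "indep G I" for I
        using part[OF that] pos sum'[OF finite_indep[OF that]] by simp
    qed
    from bound[OF this] have "sum w H / (1 - sum w K) \<le> B"
      using H(1) by (simp add: sum' pair_finite_verts Int_absorb1)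
    then show ?thesis using pos by (simp add: field_simps)
  qed
qed

text \<open>
  \<open>J d\<close> is the trace of an independent set of a generalised Mycielskian on the level at distance
  \<open>d\<close> from the apex. The set \<open>L = J m \<inter> \<dots> \<inter> J r\<close> is independent, and \<open>J (m - 1)\<close> has no
  neighbour in it, which bounds the excess of \<open>J (m - 1)\<close> in terms of \<open>1 - w(L)\<close>; the powers of
  \<open>B\<close> make these bounds telescope.
\<close>

lemma sum_levels_le:
  fixes J :: "nat \<Rightarrow> 'a set"
  assumes w: "fractional_clique G w"
    and bound: "\<And>w'. fractional_clique G w' \<Longrightarrow> sum w' (pverts G) \<le> B" and "0 \<le> B"
    and J: "\<And>d. J d \<subseteq> pverts G" and Jr: "indep G (J r)"
    and nonadj: "\<And>d u v. m \<le> d \<Longrightarrow> d < r \<Longrightarrow> u \<in> J d \<Longrightarrow> v \<in> J (Suc d) \<Longrightarrow> (u, v) \<notin> parcs G"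
    and "m \<le> r"
  shows "(\<Sum>d=m..r. B ^ d * (sum w (J d) - 1)) \<le> - (B ^ m * (1 - sum w (\<Inter>d\<in>{m..r}. J d)))"
  using \<open>m \<le> r\<close>
\<comment> \<open>Downward induction on \<open>m\<close>; for \<open>m = r\<close> both sides equal
  \<open>B ^ r * (sum w (J r) - 1)\<close>.\<close>
proof (induction rule: inc_induct)
  case base
  then show ?case by (simp add: algebra_simps)
next
  case (step n)
  define L where "L = (\<Inter>d\<in>{Suc n..r}. J d)"
  have L_sub: "L \<subseteq> J (Suc n)" "L \<subseteq> J r"
    using step.hyps unfolding L_def by auto
  have "indep G L" using Jr L_sub(2) unfolding indep_def by blast
  have L_n: "(\<Inter>d\<in>{n..r}. J d) = J n \<inter> L"
    using atLeastAtMost_insertL[of n r] step.hyps unfolding L_def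
    by (metis INT_insert less_imp_le)
  \<comment> \<open>Since \<open>L\<close> lies in \<open>J (Suc n)\<close>, no vertex of
    \<open>J n\<close> has a neighbour in \<open>L\<close>. Multiplied by \<open>B ^ n\<close>, this
    bound is cancelled exactly by the induction hypothesis.\<close>
  have "sum w (J n - L) \<le> (1 - sum w L) * B"
    using J[of n] nonadj[of n] step.hyps L_sub(1) arcs_symmetric
    by (intro sum_nonadjacent_le[OF w bound \<open>indep G L\<close>]) blast+
  moreover have "sum w (J n) = sum w (J n \<inter> L) + sum w (J n - L)"
    using J[of n] pair_finite_verts finite_subset by (intro sum.Int_Diff) blast
  ultimately have "sum w (J n) - 1 \<le> (1 - sum w L) * B - (1 - sum w (J n \<inter> L))"
    by simp
  then have "B ^ n * (sum w (J n) - 1) \<le> B ^ n * ((1 - sum w L) * B - (1 - sum w (J n \<inter> L)))"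
    by (rule mult_left_mono) (use \<open>0 \<le> B\<close> in simp)
  moreover have "(\<Sum>d=Suc n..r. B ^ d * (sum w (J d) - 1)) \<le> - (B ^ Suc n * (1 - sum w L))"
    using step.IH unfolding L_def .
  ultimately show ?case
    unfolding L_n using step.hyps by (simp add: sum.atLeast_Suc_atMost algebra_simps)
qed

end

section \<open>A generalised Mycielskian of \<open>W(s,t)\<close> inside \<open>W(s,t+1)\<close>\<close>

text \<open>
  \<open>level s d x\<close> is the image of the copy of \<open>x\<close> at distance \<open>d\<close> from the apex; level 0 collapses
  to the apex. Colour the levels with \<open>d\<close> even and \<open>d < 2s\<close> by the new colour and all other copies
  as in \<open>W(s,t)\<close>: each entry is then the length of a shortest walk to the corresponding colour
  class, capped at \<open>s\<close>.
\<close>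

definition level_entry :: "nat \<Rightarrow> nat \<Rightarrow> nat \<Rightarrow> nat" where
  "level_entry s d a =
     (if a < s \<and> odd (a + d) then min a (d + 1) else if d < s then d + 1 else max a (2 * s - d))"

definition level_last :: "nat \<Rightarrow> nat \<Rightarrow> nat" where
  "level_last s d = (if d < 2 * s - 1 then d mod 2 else min s (d - (2 * s - 2)))"

definition level :: "nat \<Rightarrow> nat \<Rightarrow> nat list \<Rightarrow> nat list" where
  "level s d x = map (level_entry s d) x @ [level_last s d]"

section \<open>Adjacent entries on consecutive levels\<close>

definition entry_adj :: "nat \<Rightarrow> nat \<Rightarrow> nat \<Rightarrow> bool" where
  "entry_adj s a b \<longleftrightarrow> \<bar>int a - int b\<bar> = 1 \<or> (a = s \<and> b = s)"

text \<open>If \<open>a\<close> and \<open>b\<close> differ by 1, then \<open>a + d\<close> and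
  \<open>b + Suc d\<close> have the same parity, so below the cap \<open>s\<close> both entries are
  computed by the same rule.\<close>

lemma entry_adj_level_entry:
  assumes "entry_adj s a b" "a \<le> s" "b \<le> s"
  shows "entry_adj s (level_entry s d a) (level_entry s (Suc d) b)"
proof -
  consider "a = s" "b = s" | "b = Suc a" | "a = Suc b"
    using assms(1) unfolding entry_adj_def by linarith
  then show ?thesis
  proof cases
    case 1
    then show ?thesis by (auto simp: level_entry_def entry_adj_def)
  next
    case 2
    show ?thesis
    proof (cases "odd (a + d)")
      case True
      then show ?thesis using 2 assms(3) by (auto simp: level_entry_def entry_adj_def)
    next
      case False
      \<comment> \<open>Parity excludes \<open>a + d = 2 * s - 1\<close>, the one value at which the
        two maxima would be attained by different arguments.\<close>
      then have "a + d + 2 \<le> 2 * s \<or> 2 * s \<le> a + d" by presburger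
      with False show ?thesis using 2 assms(3)
        by (auto simp: level_entry_def entry_adj_def max_absorb1 max_absorb2)
    qed
  next
    case 3
    show ?thesis
    proof (cases "odd (a + d)")
      case True
      \<comment> \<open>Likewise parity excludes \<open>a = d + 2\<close>, where both minima would
        be \<open>d + 1\<close>.\<close>
      then have "a \<le> d + 1 \<or> d + 3 \<le> a" using 3 by presburger
      with True show ?thesis using 3 assms(2)
        by (auto simp: level_entry_def entry_adj_def min_absorb1 min_absorb2)
    next
      case False
      then have "a + d + 2 \<le> 2 * s \<or> 2 * s \<le> a + d" by presburger
      with False show ?thesis using 3 assms(2)
        by (auto simp: level_entry_def entry_adj_def max_absorb1 max_absorb2)
    qed
  qed
qed

text \<open>As \<open>d\<close> grows, the last entry alternates between 0 and 1 up to
  \<open>d = 2 * s - 2\<close>, where it is 0, then climbs by one per level until it stays at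
  \<open>s\<close>.\<close>

lemma entry_adj_level_last:
  assumes "s > 0"
  shows "entry_adj s (level_last s d) (level_last s (Suc d))"
proof -
  consider "Suc d < 2 * s - 1" | "d = 2 * s - 2" | "2 * s - 1 \<le> d"
    by linarith
  then show ?thesis
  proof cases
    case 1
    then show ?thesis
      by (cases "even d") (simp_all add: level_last_def entry_adj_def mod2_eq_if)
  qed (use assms in \<open>auto simp: level_last_def entry_adj_def\<close>)
qed

section \<open>Ranges and special values of the entries\<close>

lemma level_entry_le: "a \<le> s \<Longrightarrow> level_entry s d a \<le> s"
  unfolding level_entry_def by auto

lemma level_last_le: "s > 0 \<Longrightarrow> level_last s d \<le> s"
  unfolding level_last_def by (auto simp: mod2_eq_if)

lemma level_entry_eq_0_iff: "s > 0 \<Longrightarrow> level_entry s d a = 0 \<longleftrightarrow> a = 0 \<and> (odd d \<or> 2 * s \<le> d)"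
  unfolding level_entry_def by (cases "a = 0") (auto simp: min_def)

lemma level_last_eq_0_iff: "s > 0 \<Longrightarrow> level_last s d = 0 \<longleftrightarrow> even d \<and> d < 2 * s"
  unfolding level_last_def by (auto simp: mod2_eq_if)

lemma level_entry_1: "s > 0 \<Longrightarrow> even d \<or> 2 * s \<le> d \<Longrightarrow> level_entry s d 1 = 1"
  unfolding level_entry_def by auto

lemma level_last_eq_1: "s > 0 \<Longrightarrow> odd d \<Longrightarrow> d < 2 * s \<Longrightarrow> level_last s d = 1"
  unfolding level_last_def by (auto simp: mod2_eq_if)

lemma level_entry_0: "s > 0 \<Longrightarrow> level_entry s 0 a = 1"
  unfolding level_entry_def by (auto elim: oddE)

lemma level_entry_bottom: "a \<le> s \<Longrightarrow> level_entry s (3 * s) a = a"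
  unfolding level_entry_def by auto

section \<open>Vertices and edges formed by the levels\<close>

lemma W_vertsD:
  assumes "x \<in> W_verts s t"
  shows "length x = t" and "i < t \<Longrightarrow> x ! i \<le> s"
proof -
  show len: "length x = t"
    using assms unfolding W_verts_def by blast
  have "set x \<subseteq> {0..s}"
    using assms unfolding W_verts_def by blast
  moreover have "x ! i \<in> set x" if "i < t"
    using that len by simp
  ultimately show "x ! i \<le> s" if "i < t"
    using that by (metis atLeastAtMost_iff subsetD)
qed

lemma nth_level:
  assumes "x \<in> W_verts s t"
  shows "i < t \<Longrightarrow> level s d x ! i = level_entry s d (x ! i)" and "level s d x ! t = level_last s d"
  using W_vertsD(1)[OF assms] by (auto simp: level_def nth_append)

lemma W_adj_Suc_iff:
  "W_adj s (Suc t) x y \<longleftrightarrow> (\<forall>i<t. entry_adj s (x ! i) (y ! i)) \<and> entry_adj s (x ! t) (y ! t)"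
  unfolding W_adj_def entry_adj_def by (auto simp: less_Suc_eq)

text \<open>For even \<open>d < 2 * s\<close> the only zero is the last entry; for all other
  \<open>d\<close> it stays where \<open>x\<close> has it. A one is supplied by the last entry for
  odd \<open>d < 2 * s\<close>, and otherwise by a one of \<open>x\<close>.\<close>

lemma level_in_W_verts:
  assumes "s > 0" and x: "x \<in> W_verts s t"
  shows "level s d x \<in> W_verts s (Suc t)"
proof -
  note nth = nth_level[OF x]
  have len: "length (level s d x) = Suc t"
    using W_vertsD(1)[OF x] by (simp add: level_def)
  have "set x \<subseteq> {0..s}"
    using x unfolding W_verts_def by blast
  then have "set (level s d x) \<subseteq> {0..s}"
    using level_entry_le level_last_le[OF \<open>s > 0\<close>] unfolding level_def by auto
  moreover have "\<exists>!i. i < Suc t \<and> level s d x ! i = 0"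
  proof (cases "even d \<and> d < 2 * s")
    case True
    then have "i < Suc t \<and> level s d x ! i = 0 \<longleftrightarrow> i = t" for i
      using nth \<open>s > 0\<close> by (auto simp: less_Suc_eq level_entry_eq_0_iff level_last_eq_0_iff)
    then show ?thesis by simp
  next
    case False
    then have "i < Suc t \<and> level s d x ! i = 0 \<longleftrightarrow> i < t \<and> x ! i = 0" for i
      using nth \<open>s > 0\<close> by (auto simp: less_Suc_eq level_entry_eq_0_iff level_last_eq_0_iff)
    then show ?thesis using x by (simp add: W_verts_def)
  qed
  moreover have "\<exists>j<Suc t. level s d x ! j = 1"
  proof (cases "odd d \<and> d < 2 * s")
    case True
    then show ?thesis using nth(2) level_last_eq_1[OF \<open>s > 0\<close>] by auto
  next
    case False
    obtain j where "j < t" "x ! j = 1" using x unfolding W_verts_def by blast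
    then show ?thesis
      using False nth(1)[of j d] level_entry_1[OF \<open>s > 0\<close>, of d] by (intro exI[of _ j]) auto
  qed
  ultimately show ?thesis using len unfolding W_verts_def by blast
qed

lemma level_0:
  assumes "s > 0" and "x \<in> W_verts s t"
  shows "level s 0 x = replicate t 1 @ [0]"
proof -
  have "level_entry s 0 = (\<lambda>_. 1)" using level_entry_0[OF \<open>s > 0\<close>] by blast
  then show ?thesis
    using assms W_vertsD(1)[OF assms(2)] by (simp add: level_def level_last_def map_replicate_const)
qed

lemma W_adj_level_Suc:
  assumes "s > 0" and x: "x \<in> W_verts s t" and y: "y \<in> W_verts s t" and adj: "W_adj s t x y"
  shows "W_adj s (Suc t) (level s d x) (level s (Suc d) y)"
  using adj entry_adj_level_entry entry_adj_level_last[OF \<open>s > 0\<close>] W_vertsD(2)[OF x] W_vertsD(2)[OF y]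
  unfolding W_adj_Suc_iff by (simp add: nth_level[OF x] nth_level[OF y] W_adj_def entry_adj_def)

text \<open>At \<open>d = 3 * s\<close> the entries of \<open>x\<close> are unchanged, and the last
  entry has reached \<open>s\<close>, which is compatible with itself.\<close>

lemma W_adj_level_bottom:
  assumes "s > 0" and x: "x \<in> W_verts s t" and y: "y \<in> W_verts s t" and adj: "W_adj s t x y"
  shows "W_adj s (Suc t) (level s (3 * s) x) (level s (3 * s) y)"
  using adj W_vertsD(2)[OF x] W_vertsD(2)[OF y] \<open>s > 0\<close>
  unfolding W_adj_Suc_iff
  by (simp add: nth_level[OF x] nth_level[OF y] level_entry_bottom W_adj_def entry_adj_def level_last_def)

text \<open>Level 0 does not depend on the vertex copied, so the edge can be checked entry by entry,
  without producing a neighbour of \<open>x\<close> in \<open>W s t\<close>.\<close>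

lemma W_adj_apex:
  assumes "s > 0" and x: "x \<in> W_verts s t"
  shows "W_adj s (Suc t) (replicate t 1 @ [0]) (level s 1 x)"
proof -
  have "entry_adj s 1 (level_entry s 1 a)" if "a \<le> s" for a
  proof -
    \<comment> \<open>Any entry adjacent to \<open>a\<close> will do, since all entries are sent to
      1 on level 0.\<close>
    have "entry_adj s (if a = 0 then 1 else a - 1) a"
      unfolding entry_adj_def by auto
    moreover have "(if a = 0 then 1 else a - 1) \<le> s"
      using \<open>s > 0\<close> that by auto
    ultimately show ?thesis
      using entry_adj_level_entry[OF _ _ that, of _ 0] level_entry_0[OF \<open>s > 0\<close>]
      by (metis One_nat_def)
  qed
  moreover have "entry_adj s 0 (level_last s 1)"
    using entry_adj_level_last[OF \<open>s > 0\<close>, of 0] \<open>s > 0\<close> by (simp add: level_last_def)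
  ultimately show ?thesis
    using W_vertsD(2)[OF x] unfolding W_adj_Suc_iff
    by (simp add: nth_append nth_level[OF x] del: One_nat_def)
qed

section \<open>Growth of the fractional clique number\<close>

lemma sum_fibres:
  assumes "finite A" "finite I"
  shows "(\<Sum>y\<in>I. sum w {x \<in> A. f x = y}) = sum w {x \<in> A. f x \<in> I}"
proof -
  have "(\<Sum>y\<in>I. sum w {x \<in> {x \<in> A. f x \<in> I}. f x = y}) = sum w {x \<in> A. f x \<in> I}"
    by (rule sum.group) (use assms in auto)
  moreover have "{x \<in> {x \<in> A. f x \<in> I}. f x = y} = {x \<in> A. f x = y}" if "y \<in> I" for y
    using that by auto
  ultimately show ?thesis by simp
qed

lemma fractional_clique_W_Suc:
  assumes "s > 0" and "W_verts s t \<noteq> {}" and w: "fractional_clique (W s t) w"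
    and bound: "\<And>w'. fractional_clique (W s t) w' \<Longrightarrow> sum w' (pverts (W s t)) \<le> B" and "B > 0"
  shows "\<exists>w'. fractional_clique (W s (Suc t)) w' \<and>
    sum w' (pverts (W s (Suc t))) = sum w (pverts (W s t)) + B / (\<Sum>d=1..3 * s. B ^ d)"
proof -
  interpret G: pair_graph "W s t" by (rule pair_graph_W[OF \<open>s > 0\<close>])
  interpret G': pair_graph "W s (Suc t)" by (rule pair_graph_W[OF \<open>s > 0\<close>])
  define V where "V = W_verts s t"
  have V: "pverts (W s t) = V" "finite V"
    using G.pair_finite_verts by (simp_all add: W_def V_def)
  have arcs: "(x, y) \<in> parcs (W s t) \<longleftrightarrow> x \<in> V \<and> y \<in> V \<and> W_adj s t x y" for x y
    by (simp add: W_def V_def)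
  have arcs': "(x, y) \<in> parcs (W s (Suc t)) \<longleftrightarrow>
      x \<in> pverts (W s (Suc t)) \<and> y \<in> pverts (W s (Suc t)) \<and> W_adj s (Suc t) x y" for x y
    by (simp add: W_def)
  have level_in: "level s d x \<in> pverts (W s (Suc t))" if "x \<in> V" for d x
    using level_in_W_verts[OF \<open>s > 0\<close>] that by (simp add: V_def W_def)
  define z where "z = replicate t (1::nat) @ [0]"
  have z: "z \<in> pverts (W s (Suc t))"
    using assms(2) level_in[of _ 0] level_0[OF \<open>s > 0\<close>] unfolding V_def z_def by fastforce
  define S where "S = (\<Sum>d=1..3 * s. B ^ d)"
  have "S > 0" unfolding S_def using \<open>B > 0\<close> \<open>s > 0\<close> by (intro sum_pos) auto
  \<comment> \<open>The level maps need not be injective, so weights are pushed forward by summing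
    over fibres.\<close>
  define w' where "w' y = ((\<Sum>d=1..3 * s. B ^ d * sum w {x \<in> V. level s d x = y}) +
    (if y = z then B else 0)) / S" for y
  define J where "J I d = {x \<in> V. level s d x \<in> I}" for I d
  have sum': "sum w' I = ((\<Sum>d=1..3 * s. B ^ d * sum w (J I d)) + (if z \<in> I then B else 0)) / S"
    if "finite I" for I
  proof -
    have "(\<Sum>y\<in>I. \<Sum>d=1..3 * s. B ^ d * sum w {x \<in> V. level s d x = y}) =
        (\<Sum>d=1..3 * s. B ^ d * (\<Sum>y\<in>I. sum w {x \<in> V. level s d x = y}))"
      unfolding sum_distrib_left by (rule sum.swap)
    also have "\<dots> = (\<Sum>d=1..3 * s. B ^ d * sum w (J I d))"
      unfolding J_def by (simp only: sum_fibres[OF V(2) that])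
    finally show ?thesis
      using that unfolding w'_def by (simp flip: sum_divide_distrib add: sum.distrib)
  qed
  have "fractional_clique (W s (Suc t)) w'"
    unfolding fractional_clique_def
  proof (intro conjI allI impI)
    show "0 \<le> w' y" for y
      unfolding w'_def using \<open>S > 0\<close> \<open>B > 0\<close> fractional_cliqueD(1)[OF w]
      by (intro divide_nonneg_pos add_nonneg_nonneg sum_nonneg mult_nonneg_nonneg) auto
  next
    fix I assume I: "indep (W s (Suc t)) I"
    have nonadj: "\<not> W_adj s (Suc t) x y" if "x \<in> I" "y \<in> I" for x y
      using I that arcs' unfolding indep_def by blast
    define L where "L = (\<Inter>d\<in>{1..3 * s}. J I d)"
    have bottom: "indep (W s t) (J I (3 * s))"
      unfolding indep_def arcs V(1)
      using nonadj W_adj_level_bottom[OF \<open>s > 0\<close>] unfolding J_def V_def by blast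
    have "L \<subseteq> J I (3 * s)" "L \<subseteq> J I 1"
      using \<open>s > 0\<close> unfolding L_def by auto
    then have "indep (W s t) L"
      using bottom unfolding indep_def by blast
    then have L_le: "sum w L \<le> 1"
      by (rule fractional_cliqueD(2)[OF w])
    \<comment> \<open>The apex is adjacent to the whole of level 1, so \<open>I\<close> cannot meet
      that level.\<close>
    have "L = {}" if "z \<in> I"
      using nonadj[OF that] W_adj_apex[OF \<open>s > 0\<close>] \<open>L \<subseteq> J I 1\<close>
      unfolding J_def z_def V_def by blast
    then have "(if z \<in> I then B else 0) \<le> B * (1 - sum w L)"
      using L_le \<open>B > 0\<close> by simp
    \<comment> \<open>The levels fall short of their total allowance \<open>S\<close> by at least
      \<open>B * (1 - sum w L)\<close>, which leaves room for the apex.\<close>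
    moreover have "(\<Sum>d=1..3 * s. B ^ d * (sum w (J I d) - 1)) \<le> - (B ^ 1 * (1 - sum w L))"
      unfolding L_def
    proof (rule G.sum_levels_le[OF w bound])
      show "(x, y) \<notin> parcs (W s t)" if "x \<in> J I d" "y \<in> J I (Suc d)" for d x y
        using that nonadj W_adj_level_Suc[OF \<open>s > 0\<close>] unfolding arcs J_def V_def by blast
    qed (use bottom \<open>B > 0\<close> \<open>s > 0\<close> V(1) in \<open>auto simp: J_def\<close>)
    ultimately have "(\<Sum>d=1..3 * s. B ^ d * sum w (J I d)) + (if z \<in> I then B else 0) \<le> S"
      by (simp add: S_def algebra_simps sum_subtractf)
    then show "sum w' I \<le> 1"
      using \<open>S > 0\<close> by (simp add: sum'[OF G'.finite_indep[OF I]])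
  qed
  moreover have "J (pverts (W s (Suc t))) d = V" for d
    using level_in unfolding J_def by blast
  \<comment> \<open>Every level carries a full copy of \<open>V\<close>, so the levels contribute
    \<open>S * sum w V\<close> and the apex contributes \<open>B\<close> before division by
    \<open>S\<close>.\<close>
  then have "sum w' (pverts (W s (Suc t))) = sum w V + B / S"
    using z \<open>S > 0\<close> unfolding sum'[OF G'.pair_finite_verts]
    by (simp add: S_def sum_distrib_right[symmetric] add_divide_distrib)
  ultimately show ?thesis unfolding V(1) S_def by blast
qed

text \<open>This form can be iterated: it does not ask \<open>B\<close> to bound all fractional
  cliques. If one of them exceeds \<open>B\<close>, the growth step with another bound carries that
  excess over to \<open>t + 1\<close>.\<close>

lemma ex_fractional_clique_W_Suc:
  assumes "s > 0" and "W_verts s t \<noteq> {}" and "B > 0"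
    and w: "fractional_clique (W s t) w"
  shows "\<exists>w'. fractional_clique (W s (Suc t)) w' \<and>
    sum w' (pverts (W s (Suc t))) \<ge> min B (sum w (pverts (W s t)) + B / (\<Sum>d=1..3 * s. B ^ d))"
proof (cases "\<forall>w'. fractional_clique (W s t) w' \<longrightarrow> sum w' (pverts (W s t)) \<le> B")
  case True
  then obtain w' where "fractional_clique (W s (Suc t)) w'"
    "sum w' (pverts (W s (Suc t))) = sum w (pverts (W s t)) + B / (\<Sum>d=1..3 * s. B ^ d)"
    using fractional_clique_W_Suc[OF assms(1,2) w _ \<open>B > 0\<close>] by blast
  then show ?thesis by (intro exI[of _ w']) simp
next
  case False
  then obtain w1 where w1: "fractional_clique (W s t) w1" "B < sum w1 (pverts (W s t))"
    by (auto simp: not_le)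
  interpret pair_graph "W s t" by (rule pair_graph_W[OF \<open>s > 0\<close>])
  \<comment> \<open>Any positive valid bound works here, as only a nonnegative gain is required; the
    summand 1 makes positivity immediate.\<close>
  define C where "C = 1 + real (card (pverts (W s t)))"
  have "sum w' (pverts (W s t)) \<le> C" if "fractional_clique (W s t) w'" for w'
    using fractional_clique_le_card[OF that] by (simp add: C_def)
  moreover have "C > 0" by (simp add: C_def)
  ultimately obtain w2 where w2: "fractional_clique (W s (Suc t)) w2"
    "sum w2 (pverts (W s (Suc t))) = sum w1 (pverts (W s t)) + C / (\<Sum>d=1..3 * s. C ^ d)"
    using fractional_clique_W_Suc[OF assms(1,2) w1(1)] by blast
  have "0 \<le> C / (\<Sum>d=1..3 * s. C ^ d)"
    using \<open>C > 0\<close> by (intro divide_nonneg_nonneg sum_nonneg) auto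
  then have "B \<le> sum w2 (pverts (W s (Suc t)))" using w1(2) w2(2) by linarith
  then show ?thesis using w2(1) by (intro exI[of _ w2]) (simp add: min.coboundedI1)
qed

section \<open>Iterating the growth step\<close>

lemma W_verts_nonempty:
  assumes "s > 0" "t \<ge> 2"
  shows "W_verts s t \<noteq> {}"
proof -
  define x where "x = 0 # replicate (t - 1) (1::nat)"
  have "length x = t" and "set x \<subseteq> {0..s}"
    using assms by (auto simp: x_def)
  moreover have "i < t \<and> x ! i = 0 \<longleftrightarrow> i = 0" for i
    using assms by (cases i) (auto simp: x_def)
  then have "\<exists>!i. i < t \<and> x ! i = 0" by simp
  moreover have "\<exists>j<t. x ! j = 1"
    using assms by (intro exI[of _ 1]) (simp add: x_def)
  ultimately have "x \<in> W_verts s t"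
    unfolding W_verts_def by blast
  then show ?thesis by blast
qed

theorem theorem7:
  fixes s :: nat
  assumes "s > 0"
  shows "filterlim (\<lambda>t. fractional_chromatic (W s t)) at_top sequentially"
  unfolding filterlim_at_top_gt[where c = 0]
proof (intro allI impI)
  fix B :: real
  assume "B > 0"
  define \<delta> where "\<delta> = B / (\<Sum>d=1..3 * s. B ^ d)"
  have "\<delta> > 0"
    unfolding \<delta>_def using \<open>B > 0\<close> \<open>s > 0\<close> by (intro divide_pos_pos sum_pos) auto
  \<comment> \<open>The iteration starts at length 2, the least that has room for a zero and a one,
    with the zero weighting; each step gains \<delta> until \<open>B\<close> is reached.\<close>
  have clique: "\<exists>w. fractional_clique (W s (n + 2)) w \<and>
      sum w (pverts (W s (n + 2))) \<ge> min B (real n * \<delta>)" for n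
  proof (induction n)
    case 0
    show ?case
      using \<open>B > 0\<close> by (intro exI[of _ "\<lambda>_. 0"]) (auto simp: fractional_clique_def)
  next
    case (Suc n)
    then obtain w where "fractional_clique (W s (n + 2)) w"
      and "sum w (pverts (W s (n + 2))) \<ge> min B (real n * \<delta>)" by blast
    moreover from this(1) obtain w' where w': "fractional_clique (W s (Suc (n + 2))) w'"
      and "sum w' (pverts (W s (Suc (n + 2)))) \<ge> min B (sum w (pverts (W s (n + 2))) + \<delta>)"
      using ex_fractional_clique_W_Suc[OF \<open>s > 0\<close> W_verts_nonempty[OF \<open>s > 0\<close> le_add2] \<open>B > 0\<close>]
      unfolding \<delta>_def by blast
    moreover have "real (Suc n) * \<delta> = real n * \<delta> + \<delta>"
      by (simp add: algebra_simps)
    ultimately have "sum w' (pverts (W s (Suc (n + 2)))) \<ge> min B (real (Suc n) * \<delta>)"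
      using \<open>\<delta> > 0\<close> by linarith
    then show ?case using w' by auto
  qed
  obtain N where N: "B < real N * \<delta>"
    using reals_Archimedean3[OF \<open>\<delta> > 0\<close>] by blast
  show "\<forall>\<^sub>F t in sequentially. B \<le> fractional_chromatic (W s t)"
  proof (rule eventually_sequentiallyI)
    fix t
    assume "N + 2 \<le> t"
    then have n: "t = (t - 2) + 2" "N \<le> t - 2" by auto
    have "real N * \<delta> \<le> real (t - 2) * \<delta>"
      using n(2) \<open>\<delta> > 0\<close> by simp
    then obtain w where "fractional_clique (W s t) w" "B \<le> sum w (pverts (W s t))"
      using clique[of "t - 2"] N n(1) by auto
    then show "B \<le> fractional_chromatic (W s t)"
      using pair_graph.fractional_clique_le_fractional_chromatic[OF pair_graph_W[OF \<open>s > 0\<close>]]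
      by fastforce
  qed
qed

end
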